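(* Let $\mu$ be a Borel probability measure on $2^\omega$. Let $(s_i)_{i\in\omega}$ be reals with $s_i\in[0,1)$ and $\sum_i s_i<\infty$, and let $(A_i)_{i\in\omega}$ be subsets of $2^\omega$ such that player II has a winning strategy in the measure game $G(s_i,A_i)$ for every $i$. Then player II has a winning strategy in $G\big(0,\bigcup_{m=1}^\infty\bigcap_{i=m}^\infty A_i\big)$.
   Context: $2^\omega$ is the space of infinite binary sequences with the product topology; $2^{<\omega}$ is the set of finite binary sequences; for $t\in 2^{<\omega}$, $N_t=\{x\in 2^\omega: t\subseteq x\}$, and $t^\frown i$ denotes $t$ extended by the digit $i$. For $A\subseteq 2^\omega$ and $s\in[0,1)$ the measure game $G(s,A)$ is played as follows: in round $n$, after II has played $t=x_0\dots x_{n-1}$ (for $n=0$, $t=\emptyset$), player I plays a pair $(m_{t^\frown 0},m_{t^\frown 1})$, and then II plays $x_n$. Put $m_\emptyset=m_0+m_1$. Player I must obey: every $m_t$ is rational; $m_0+m_1>s$; $0\le m_t\le\mu(N_t)$; if $\mu(N_t)>0$ then $m_t<\mu(N_t)$; $m_{t^\frown0}+m_{t^\frown1}=m_t$. Player II must obey: $x_n\in\{0,1\}$ and $m_{x_0\dots x_n}\ne 0$ for all $n$. The first player to violate a rule loses; if both follow the rules, II wins iff $x=(x_0,x_1,\dots)\in A$, and otherwise I wins. *)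

theory Defs
  imports "HOL-Probability.Probability"
begin

text \<open>
  The space $2^\omega$ is the type \<open>nat \<Rightarrow> bool\<close> with the library's product topology
  (\<open>bool\<close> is discrete), and $2^{<\omega}$ is the type \<open>bool list\<close>; the digits 0 and 1 are
  \<open>False\<close> and \<open>True\<close>.
\<close>

definition restr :: "(nat \<Rightarrow> 'a) \<Rightarrow> nat \<Rightarrow> 'a list" where
  "restr x n = map x [0..<n]"

definition cyl :: "bool list \<Rightarrow> (nat \<Rightarrow> bool) set" where
  "cyl t = {x. restr x (length t) = t}"

text \<open>
  A run of the measure game consists of the moves \<open>p :: nat \<Rightarrow> real \<times> real\<close> of player I and the
  moves \<open>x :: nat \<Rightarrow> bool\<close> of player II. With \<open>t = restr x n\<close>, the pair \<open>p n\<close> is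
  $(m_{t^\frown 0}, m_{t^\frown 1})$, so only the numbers $m_u$ with \<open>u\<close> empty or of the form
  $t^\frown i$ occur in the run. Here \<open>run_mass p x n\<close> is $m_t$; player I's moves are arbitrary
  pairs of reals, and rationality is one of the rules.
\<close>

definition choose_mass :: "real \<times> real \<Rightarrow> bool \<Rightarrow> real" where
  "choose_mass q i = (if i then snd q else fst q)"

fun run_mass :: "(nat \<Rightarrow> real \<times> real) \<Rightarrow> (nat \<Rightarrow> bool) \<Rightarrow> nat \<Rightarrow> real" where
  "run_mass p x 0 = fst (p 0) + snd (p 0)"
| "run_mass p x (Suc n) = choose_mass (p n) (x n)"

definition legal_mass :: "(nat \<Rightarrow> bool) measure \<Rightarrow> bool list \<Rightarrow> real \<Rightarrow> bool" where
  "legal_mass \<mu> t m \<longleftrightarrow>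
     m \<in> \<rat> \<and> 0 \<le> m \<and> m \<le> measure \<mu> (cyl t) \<and>
     (measure \<mu> (cyl t) > 0 \<longrightarrow> m < measure \<mu> (cyl t))"

definition legal_I ::
  "(nat \<Rightarrow> bool) measure \<Rightarrow> real \<Rightarrow> (nat \<Rightarrow> real \<times> real) \<Rightarrow> (nat \<Rightarrow> bool) \<Rightarrow> nat \<Rightarrow> bool" where
  "legal_I \<mu> s p x n \<longleftrightarrow>
     (n = 0 \<longrightarrow> fst (p 0) + snd (p 0) > s \<and> legal_mass \<mu> [] (run_mass p x 0)) \<and>
     (\<forall>i. legal_mass \<mu> (restr x n @ [i]) (choose_mass (p n) i)) \<and>
     fst (p n) + snd (p n) = run_mass p x n"

text \<open>The rule $x_n \in \{0,1\}$ is enforced by the type of player II's moves.\<close>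

definition legal_II :: "(nat \<Rightarrow> real \<times> real) \<Rightarrow> (nat \<Rightarrow> bool) \<Rightarrow> nat \<Rightarrow> bool" where
  "legal_II p x n \<longleftrightarrow> run_mass p x (Suc n) \<noteq> 0"

text \<open>
  Player I moves first in each round, so player I is the first to violate a rule iff in some round
  \<open>n\<close> player I's move is illegal while all moves of both players in earlier rounds are legal.
\<close>

definition II_wins_run ::
  "(nat \<Rightarrow> bool) measure \<Rightarrow> real \<Rightarrow> (nat \<Rightarrow> bool) set \<Rightarrow>
   (nat \<Rightarrow> real \<times> real) \<Rightarrow> (nat \<Rightarrow> bool) \<Rightarrow> bool" where
  "II_wins_run \<mu> s A p x \<longleftrightarrow>
     (\<exists>n. \<not> legal_I \<mu> s p x n \<and> (\<forall>k<n. legal_I \<mu> s p x k \<and> legal_II p x k)) \<or>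
     ((\<forall>n. legal_I \<mu> s p x n \<and> legal_II p x n) \<and> x \<in> A)"

text \<open>
  A strategy of player II maps a position in which player II is to move, given by the moves
  $p_0, \dots, p_n$ of player I and the moves $x_0, \dots, x_{n-1}$ of player II, to a move $x_n$.
\<close>

type_synonym strategy_II = "(real \<times> real) list \<Rightarrow> bool list \<Rightarrow> bool"

definition follows_II ::
  "strategy_II \<Rightarrow> (nat \<Rightarrow> real \<times> real) \<Rightarrow> (nat \<Rightarrow> bool) \<Rightarrow> bool" where
  "follows_II \<tau> p x \<longleftrightarrow> (\<forall>n. x n = \<tau> (restr p (Suc n)) (restr x n))"

definition winning_strategy_II ::
  "(nat \<Rightarrow> bool) measure \<Rightarrow> real \<Rightarrow> (nat \<Rightarrow> bool) set \<Rightarrow> strategy_II \<Rightarrow> bool" where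
  "winning_strategy_II \<mu> s A \<tau> \<longleftrightarrow>
     (\<forall>p x. follows_II \<tau> p x \<longrightarrow> II_wins_run \<mu> s A p x)"

definition II_has_winning_strategy ::
  "(nat \<Rightarrow> bool) measure \<Rightarrow> real \<Rightarrow> (nat \<Rightarrow> bool) set \<Rightarrow> bool" where
  "II_has_winning_strategy \<mu> s A \<longleftrightarrow> (\<exists>\<tau>. winning_strategy_II \<mu> s A \<tau>)"

end

theory Submission
  imports Defs
begin

text \<open>
  A winning strategy of II in \<open>G(s, A)\<close> forces \<open>A\<close> to contain a Borel set of measure at least
  \<open>1 - s\<close>: the outcomes reachable against the strategy form a subset of \<open>A\<close> that is measurable up
  to null sets, and if its complement had measure above \<open>s\<close>, player I could distribute masses along
  a closed subset of that complement and steer the run into it. Conversely, II wins \<open>G(0, A)\<close> if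
  \<open>A\<close> contains a Borel set \<open>E\<close> of full measure: once the initial mass \<open>m\<close> is known, II picks a
  closed \<open>F \<subseteq> E\<close> of measure above \<open>1 - m\<close> and keeps the current mass \<open>m\<^sub>t\<close> above the measure of
  \<open>N\<^sub>t - F\<close>. The two facts are linked by the Borel--Cantelli lemma.
\<close>

section \<open>Cylinders, topology and measure on the Cantor space\<close>

lemma length_restr [simp]: "length (restr x n) = n"
  by (simp add: restr_def)

lemma restr_0 [simp]: "restr x 0 = []"
  by (simp add: restr_def)

lemma restr_Suc: "restr x (Suc n) = restr x n @ [x n]"
  by (simp add: restr_def)

lemma restr_eq_iff: "restr x n = restr y n \<longleftrightarrow> (\<forall>i<n. x i = y i)"
  by (auto simp: restr_def)

lemma mem_cyl_restr [simp]: "y \<in> cyl (restr x n) \<longleftrightarrow> restr y n = restr x n"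
  by (simp add: cyl_def)

lemma cyl_Nil [simp]: "cyl [] = UNIV"
  by (simp add: cyl_def)

lemma cyl_split: "cyl t = cyl (t @ [False]) \<union> cyl (t @ [True])"
  by (auto simp: cyl_def restr_Suc)

lemma cyl_disjoint: "cyl (t @ [False]) \<inter> cyl (t @ [True]) = {}"
  by (auto simp: cyl_def restr_Suc)

lemma open_contains_cyl:
  assumes "open U" "x \<in> U"
  shows "\<exists>n. cyl (restr x n) \<subseteq> U"
proof -
  have "openin (product_topology (\<lambda>i. euclidean) UNIV) U"
    using assms(1) by (simp add: open_fun_def)
  from product_topology_open_contains_basis[OF this assms(2)]
  obtain X where X: "x \<in> (\<Pi>\<^sub>E i\<in>UNIV. X i)" "finite {i. X i \<noteq> UNIV}" "(\<Pi>\<^sub>E i\<in>UNIV. X i) \<subseteq> U"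
    by auto
  \<comment> \<open>A basic open set constrains finitely many coordinates; \<open>n\<close> bounds
    them all.\<close>
  obtain n where n: "\<forall>i\<in>{i. X i \<noteq> UNIV}. i < n"
    using X(2) finite_nat_set_iff_bounded by blast
  have "cyl (restr x n) \<subseteq> (\<Pi>\<^sub>E i\<in>UNIV. X i)"
    using n X(1) by (fastforce simp: restr_eq_iff PiE_iff)
  with X(3) show ?thesis by blast
qed

text \<open>Both players rely on this to steer the outcome of a run into a closed set: a condition
  on each finite position settles membership of the limit.\<close>

lemma closed_mem_if_meets_cyls:
  assumes "closed K" "\<And>n. K \<inter> cyl (restr x n) \<noteq> {}"
  shows "x \<in> K"
proof (rule ccontr)
  assume "x \<notin> K"
  then obtain n where "cyl (restr x n) \<subseteq> - K"
    using open_contains_cyl[of "- K" x] assms(1) by (auto simp: open_Compl)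
  with assms(2)[of n] show False by blast
qed

lemma cyl_eq: "cyl t = (\<Inter>i\<in>{..<length t}. {x. x i = t ! i})"
  by (auto simp: cyl_def restr_def list_eq_iff_nth_eq[of "map _ _"])

lemma closed_cyl: "closed (cyl t)"
proof -
  have "closed {x :: nat \<Rightarrow> bool. x i = t ! i}" for i
    by (intro closed_Collect_eq continuous_intros continuous_on_product_coordinates)
  then show ?thesis by (auto simp: cyl_eq)
qed

lemma cyl_borel [measurable]: "cyl t \<in> sets borel"
  using closed_cyl by (rule borel_closed)

lemma measure_cyl_split:
  assumes "prob_space \<mu>" "sets \<mu> = sets borel" "B \<in> sets borel"
  shows "measure \<mu> (B \<inter> cyl t) = measure \<mu> (B \<inter> cyl (t @ [False])) + measure \<mu> (B \<inter> cyl (t @ [True]))"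
proof -
  interpret prob_space \<mu> by fact
  have "B \<inter> cyl t = (B \<inter> cyl (t @ [False])) \<union> (B \<inter> cyl (t @ [True]))"
    using cyl_split[of t] by blast
  moreover have "(B \<inter> cyl (t @ [False])) \<inter> (B \<inter> cyl (t @ [True])) = {}"
    using cyl_disjoint[of t] by blast
  ultimately show ?thesis
    using assms(2,3) by (simp add: finite_measure_Union)
qed

text \<open>
  The library proves inner regularity on complete metric spaces, and \<open>bool\<close> carries no metric, so
  the measure is pushed forward to the Polish space \<open>nat \<Rightarrow> real\<close>.
\<close>

lemma closed_inner_regular:
  fixes \<mu> :: "(nat \<Rightarrow> bool) measure"
  assumes "prob_space \<mu>" and sets: "sets \<mu> = sets borel" and B: "B \<in> sets borel"
    and c: "c < measure \<mu> B"
  shows "\<exists>K. closed K \<and> K \<subseteq> B \<and> c < measure \<mu> K"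
\<comment> \<open>\<open>ennreal\<close> truncates negative reals to 0, so the comparison transfers
  only for nonnegative \<open>c\<close>; a negative \<open>c\<close> is beaten by the empty
  set.\<close>
proof (cases "0 \<le> c")
  case False
  then show ?thesis by (intro exI[of _ "{}"]) auto
next
  case True
  interpret prob_space \<mu> by fact
  have [measurable_cong]: "sets \<mu> = sets borel" by (fact sets)
  \<comment> \<open>\<open>f\<close> embeds the Cantor space into the real sequences, and
    thresholding at 1/2 gives a Borel left inverse \<open>g\<close>. A compact subset of the
    \<open>g\<close>-preimage of \<open>B\<close> therefore pulls back along \<open>f\<close> to a
    closed subset of \<open>B\<close>.\<close>
  define f :: "(nat \<Rightarrow> bool) \<Rightarrow> nat \<Rightarrow> real" where "f x n = of_bool (x n)" for x n
  define g :: "(nat \<Rightarrow> real) \<Rightarrow> nat \<Rightarrow> bool" where "g y n \<longleftrightarrow> y n > 1/2" for y n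
  have gf: "g (f x) = x" for x by (rule ext) (simp add: f_def g_def)
  have cf: "continuous_on UNIV f"
  proof (rule continuous_on_coordinatewise_then_product)
    fix n
    have "continuous_on UNIV (of_bool :: bool \<Rightarrow> real)"
      by (simp add: continuous_on_open_vimage open_discrete)
    then have "continuous_on UNIV ((of_bool :: bool \<Rightarrow> real) \<circ> (\<lambda>x :: nat \<Rightarrow> bool. x n))"
      by (intro continuous_on_compose continuous_on_product_coordinates)
        (auto intro: continuous_on_subset)
    then show "continuous_on UNIV (\<lambda>x. f x n)" by (simp add: f_def o_def)
  qed
  have f[measurable]: "f \<in> borel_measurable \<mu>"
    using borel_measurable_continuous_onI[OF cf] by simp
  have g_cyl: "g -` cyl t \<in> sets borel" for t
  proof -
    have "open {y :: nat \<Rightarrow> real. y i > 1/2}" "closed {y :: nat \<Rightarrow> real. y i \<le> 1/2}" for i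
      by (intro open_Collect_less closed_Collect_le continuous_intros
          continuous_on_product_coordinates)+
    then have "{y. g y i = b} \<in> sets borel" for i b
      by (cases b) (auto simp: g_def not_less)
    moreover have "g -` cyl t = (\<Inter>i\<in>{..<length t}. {y. g y i = t ! i})"
      by (auto simp: cyl_eq)
    ultimately show ?thesis
      by (cases "t = []") (auto intro!: sets.finite_INT)
  qed
  have g: "g \<in> borel_measurable borel"
  proof (rule borel_measurableI)
    fix U :: "(nat \<Rightarrow> bool) set" assume "open U"
    \<comment> \<open>There are only countably many cylinders, so measurability of \<open>g\<close>
      reduces to them.\<close>
    then have "U = (\<Union>t\<in>{t. cyl t \<subseteq> U}. cyl t)"
      using open_contains_cyl by fastforce
    then have "g -` U = (\<Union>t\<in>{t. cyl t \<subseteq> U}. g -` cyl t)"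
      by blast
    also have "\<dots> \<in> sets borel"
      using g_cyl by (intro sets.countable_UN') auto
    finally show "g -` U \<inter> space borel \<in> sets borel" by simp
  qed
  define N where "N = distr \<mu> borel f"
  have gB: "g -` B \<in> sets borel" using measurable_sets[OF g B] by simp
  interpret N: prob_space N unfolding N_def by (rule prob_space_distr) (rule f)
  have space: "space \<mu> = UNIV" using sets_eq_imp_space_eq[OF sets] by simp
  have N: "emeasure N C = emeasure \<mu> (f -` C)" if "C \<in> sets borel" for C
    using that by (simp add: N_def emeasure_distr space)
  have "f -` g -` B = B" by (auto simp: gf)
  then have "emeasure N (g -` B) = ennreal (measure \<mu> B)"
    by (simp add: N[OF gB] emeasure_eq_measure)
  moreover have "emeasure N (g -` B) = (SUP K \<in> {K. K \<subseteq> g -` B \<and> compact K}. emeasure N K)"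
    by (rule inner_regular[OF _ _ gB]) (auto simp: N_def N.emeasure_finite[unfolded N_def])
  ultimately have "ennreal c < (SUP K \<in> {K. K \<subseteq> g -` B \<and> compact K}. emeasure N K)"
    using c True by (metis ennreal_less_iff)
  then obtain K where K: "K \<subseteq> g -` B" "compact K" "ennreal c < emeasure N K"
    unfolding less_SUP_iff by auto
  have "closed (f -` K)"
    using closed_vimage[OF compact_imp_closed[OF K(2)] cf] .
  moreover have "f -` K \<subseteq> B" using K(1) gf by fastforce
  moreover have "c < measure \<mu> (f -` K)"
    using K(3) N[of K] borel_compact[OF K(2)] True
    by (simp add: emeasure_eq_measure ennreal_less_iff)
  ultimately show ?thesis by blast
qed

section \<open>Outcomes reachable against a strategy of player II\<close>

text \<open>A Suslin scheme indexed by the opening moves of player I. For empty \<open>ps\<close> it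
  is the projection of a set of runs that is closed for discrete moves, since each rule reads only
  finitely many of them.\<close>

definition reachable ::
  "(nat \<Rightarrow> bool) measure \<Rightarrow> real \<Rightarrow> strategy_II \<Rightarrow> (real \<times> real) list \<Rightarrow> (nat \<Rightarrow> bool) set" where
  "reachable \<mu> s \<tau> ps =
     {x. \<exists>p. follows_II \<tau> p x \<and> (\<forall>n. legal_I \<mu> s p x n \<and> legal_II p x n) \<and>
          restr p (length ps) = ps}"

lemma reachable_subset:
  assumes "winning_strategy_II \<mu> s A \<tau>"
  shows "reachable \<mu> s \<tau> ps \<subseteq> A"
  using assms unfolding reachable_def winning_strategy_II_def II_wins_run_def by blast

text \<open>Rationality of the masses leaves player I only countably many legal moves, which is what
  allows the null sets of all positions to be collected into one.\<close>

lemma reachable_step: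
  "reachable \<mu> s \<tau> ps \<subseteq> (\<Union>q\<in>\<rat> \<times> \<rat>. reachable \<mu> s \<tau> (ps @ [q]))"
proof
  fix x assume "x \<in> reachable \<mu> s \<tau> ps"
  then obtain p where p: "follows_II \<tau> p x" "\<And>n. legal_I \<mu> s p x n \<and> legal_II p x n"
      "restr p (length ps) = ps"
    by (auto simp: reachable_def)
  let ?q = "p (length ps)"
  have "choose_mass ?q i \<in> \<rat>" for i
    using p(2)[of "length ps"] by (auto simp: legal_I_def legal_mass_def)
  from this[of False] this[of True] have "?q \<in> \<rat> \<times> \<rat>"
    by (auto simp: choose_mass_def mem_Times_iff)
  moreover have "x \<in> reachable \<mu> s \<tau> (ps @ [?q])"
    using p by (auto simp: reachable_def restr_Suc)
  ultimately show "x \<in> (\<Union>q\<in>\<rat> \<times> \<rat>. reachable \<mu> s \<tau> (ps @ [q]))" by (rule UN_I)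
qed

text \<open>A mass is determined by the previous round, except that the initial mass is read off
  \<open>p 0\<close>; agreement of the moves of player I up to \<open>Suc n\<close> covers the case
  \<open>n = 0\<close>.\<close>

lemma run_mass_cong:
  assumes "restr p (Suc n) = restr p' (Suc n)" "restr x n = restr x' n"
  shows "run_mass p x n = run_mass p' x' n"
proof (cases n)
  case 0
  then show ?thesis using assms(1) by (simp add: restr_Suc)
next
  case (Suc k)
  then have "p k = p' k" "x k = x' k" using assms by (auto simp: restr_Suc)
  with Suc show ?thesis by simp
qed

lemma legal_I_cong:
  assumes "restr p (Suc n) = restr p' (Suc n)" "restr x n = restr x' n"
  shows "legal_I \<mu> s p x n = legal_I \<mu> s p' x' n"
proof -
  have "p n = p' n" "p 0 = p' 0" using assms(1) by (auto simp: restr_eq_iff)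
  moreover have "run_mass p x 0 = run_mass p' x' 0"
    using \<open>p 0 = p' 0\<close> by simp
  ultimately show ?thesis
    unfolding legal_I_def using run_mass_cong[OF assms] assms(2) by simp
qed

text \<open>The witness \<open>y\<close> and its run may change with \<open>n\<close>. The rules and
  the strategy in round \<open>n\<close> read at most the first \<open>Suc n\<close> moves of each
  player, so they pass to the limit run of \<open>p\<close> and \<open>x\<close>.\<close>

lemma reachable_limit:
  assumes "\<And>n. \<exists>y\<in>reachable \<mu> s \<tau> (restr p n). restr y n = restr x n"
  shows "x \<in> reachable \<mu> s \<tau> []"
proof -
  have "x n = \<tau> (restr p (Suc n)) (restr x n) \<and> legal_I \<mu> s p x n \<and> legal_II p x n" for n
  proof -
    obtain y p' where y: "follows_II \<tau> p' y" "\<And>n. legal_I \<mu> s p' y n \<and> legal_II p' y n"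
        "restr p' (Suc n) = restr p (Suc n)" "restr y (Suc n) = restr x (Suc n)"
      using assms[of "Suc n"] by (auto simp: reachable_def)
    have r: "restr y n = restr x n" "y n = x n" "p' n = p n"
      using y(3,4) by (auto simp: restr_eq_iff)
    have "x n = \<tau> (restr p (Suc n)) (restr x n)"
      using y(1) unfolding follows_II_def y(3)[symmetric] r(1,2)[symmetric] by blast
    moreover have "legal_I \<mu> s p x n"
      using y(2) legal_I_cong[OF y(3) r(1), of \<mu> s] by simp
    moreover have "legal_II p x n"
      using y(2)[of n] r by (simp add: legal_II_def)
    ultimately show ?thesis by blast
  qed
  then show ?thesis
    by (auto simp: reachable_def follows_II_def)
qed

text \<open>The cylinders of length \<open>n\<close> that meet \<open>R\<close> cover
  \<open>R\<close>, so an envelope can be chosen inside their union. This supplies the approximating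
  witnesses for \<open>reachable_limit\<close>.\<close>

lemma ex_envelope_within_cyls:
  fixes \<mu> :: "(nat \<Rightarrow> bool) measure"
  assumes "prob_space \<mu>" "sets \<mu> = sets borel"
  shows "\<exists>H. measurable_envelope \<mu> R H \<and> (\<forall>x\<in>H. \<exists>y\<in>R. restr y n = restr x n)"
proof -
  interpret prob_space \<mu> by fact
  let ?C = "\<Union>t\<in>(\<lambda>y. restr y n) ` R. cyl t"
  have C: "?C \<in> sets \<mu>"
    unfolding assms(2) by (intro sets.countable_UN' cyl_borel) auto
  have "R \<subseteq> (\<Union>_::nat. ?C)" by auto
  from measurable_envelopeI_countable_cover[OF this C]
  obtain H where "H \<subseteq> ?C" "measurable_envelope \<mu> R H"
    by (auto simp: less_top[symmetric])
  then show ?thesis by fastforce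
qed

text \<open>
  The reachable set of outcomes is analytic. The Lusin--Sierpinski argument shows that it differs
  from its measurable envelope by a null set: outside countably many null sets, membership in the
  envelope of a position passes to the envelope of one of its extensions.
\<close>

lemma reachable_inner_approx:
  fixes \<mu> :: "(nat \<Rightarrow> bool) measure"
  assumes "prob_space \<mu>" "sets \<mu> = sets borel"
  shows "\<exists>E H. E \<in> sets borel \<and> H \<in> sets borel \<and> E \<subseteq> reachable \<mu> s \<tau> [] \<and>
    reachable \<mu> s \<tau> [] \<subseteq> H \<and> measure \<mu> E = measure \<mu> H"
proof -
  interpret prob_space \<mu> by fact
  let ?R = "reachable \<mu> s \<tau>"
  have "\<forall>ps. \<exists>H. measurable_envelope \<mu> (?R ps) H \<and>
      (\<forall>x\<in>H. \<exists>y\<in>?R ps. restr y (length ps) = restr x (length ps))"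
    using ex_envelope_within_cyls[OF assms] by blast
  then obtain H where env: "\<And>ps. measurable_envelope \<mu> (?R ps) (H ps)"
    and near: "\<And>ps x. x \<in> H ps \<Longrightarrow> \<exists>y\<in>?R ps. restr y (length ps) = restr x (length ps)"
    by metis
  note H = measurable_envelopeD(1,2)[OF env]
  have cQ: "countable (\<rat> \<times> \<rat> :: (real \<times> real) set)"
    by (simp add: countable_rat)
  define Z where "Z ps = H ps - (\<Union>q\<in>\<rat> \<times> \<rat>. H (ps @ [q]))" for ps
  have Z: "Z ps \<in> null_sets \<mu>" for ps
  proof
    show *: "Z ps \<in> sets \<mu>"
      unfolding Z_def using H(2) cQ by (intro sets.Diff sets.countable_UN') auto
    have "?R ps \<subseteq> (\<Union>q\<in>\<rat> \<times> \<rat>. H (ps @ [q]))"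
      by (rule order_trans[OF reachable_step]) (intro UN_mono order_refl H(1))
    \<comment> \<open>A measurable part of the envelope that misses the enveloped set is
      null.\<close>
    then have "Z ps \<subseteq> H ps - ?R ps" unfolding Z_def by blast
    then show "emeasure \<mu> (Z ps) = 0"
      by (rule measurable_envelopeD1[OF env *])
  qed
  define W where "W = (\<Union>ps\<in>lists (\<rat> \<times> \<rat>). Z ps)"
  have W: "W \<in> null_sets \<mu>"
    unfolding W_def using cQ Z by (intro null_sets_UN') (auto intro: countable_lists)
  have "H [] - W \<subseteq> ?R []"
  proof
    fix x assume x: "x \<in> H [] - W"
    let ?P = "\<lambda>ps. ps \<in> lists (\<rat> \<times> \<rat>) \<and> x \<in> H ps"
    have step: "\<exists>q. ?P (ps @ [q])" if P: "?P ps" for ps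
    proof -
      have "x \<notin> Z ps" using P x by (auto simp: W_def)
      then obtain q where "q \<in> \<rat> \<times> \<rat>" "x \<in> H (ps @ [q])"
        using P by (auto simp: Z_def)
      with P show ?thesis by auto
    qed
    have "\<exists>ps. ps 0 = [] \<and> (\<forall>n. ?P (ps n) \<and> (\<exists>q. ps (Suc n) = ps n @ [q]))"
    proof -
      \<comment> \<open>The clause for \<open>n = 0\<close> anchors the chosen branch at the empty
        position, so its nodes are the initial segments of a single sequence
        \<open>p\<close>.\<close>
      have "\<exists>ps. \<forall>n. (?P (ps n) \<and> (n = 0 \<longrightarrow> ps n = [])) \<and> (\<exists>q. ps (Suc n) = ps n @ [q])"
      proof (rule dependent_nat_choice)
        show "\<exists>ps. ?P ps \<and> ((0::nat) = 0 \<longrightarrow> ps = [])" using x by auto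
        fix ps and n :: nat assume "?P ps \<and> (n = 0 \<longrightarrow> ps = [])"
        then show "\<exists>ps'. (?P ps' \<and> (Suc n = 0 \<longrightarrow> ps' = [])) \<and> (\<exists>q. ps' = ps @ [q])"
          using step by blast
      qed
      then show ?thesis by blast
    qed
    then obtain ps where ps: "ps 0 = []" "\<And>n. ?P (ps n)" "\<And>n. \<exists>q. ps (Suc n) = ps n @ [q]"
      by blast
    then obtain p where p: "\<And>n. ps (Suc n) = ps n @ [p n]" by metis
    have "ps n = restr p n" for n
      by (induction n) (auto simp: ps(1) p restr_Suc)
    then have "x \<in> H (restr p n)" for n using ps(2)[of n] by simp
    then show "x \<in> ?R []"
      using near[of x "restr p n" for n] by (intro reachable_limit[of \<mu> s \<tau> p]) simp
  qed
  moreover have "measure \<mu> (H [] - W) = measure \<mu> (H [])"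
    using H(2)[of "[]"] W by (simp add: measure_Diff_null_set)
  moreover have "H [] - W \<in> sets borel" "H [] \<in> sets borel"
    using H(2)[of "[]"] W assms(2) by auto
  ultimately show ?thesis using H(1)[of "[]"] by blast
qed

section \<open>Player I aiming at a closed set\<close>

text \<open>The recursion carries both histories; player II answers a history that already contains
  the current move of player I.\<close>

lemma ex_run_against:
  obtains p x where "follows_II \<tau> p x" "\<And>n. p n = \<sigma> (restr p n) (restr x n)"
proof -
  define st where "st = rec_nat ([], [])
    (\<lambda>_ (ps, xs). (ps @ [\<sigma> ps xs], xs @ [\<tau> (ps @ [\<sigma> ps xs]) xs]))"
  define p where "p n = (case st n of (ps, xs) \<Rightarrow> \<sigma> ps xs)" for n
  define x where "x n = (case st n of (ps, xs) \<Rightarrow> \<tau> (ps @ [\<sigma> ps xs]) xs)" for n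
  have st: "st n = (restr p n, restr x n)" for n
    by (induction n) (auto simp: st_def p_def x_def restr_Suc)
  have p: "p n = \<sigma> (restr p n) (restr x n)" for n
    using st[of n] unfolding p_def by simp
  moreover have "x n = \<tau> (restr p (Suc n)) (restr x n)" for n
    using st[of n] p[of n] unfolding x_def[of n] by (simp add: restr_Suc)
  ultimately show ?thesis
    using that by (auto simp: follows_II_def)
qed

text \<open>This is one move of player I, with \<open>a\<close> and \<open>b\<close> bounding the
  masses of the two extensions. If one side can carry all of \<open>m\<close>, the other gets 0;
  otherwise any rational strictly between \<open>m - b\<close> and \<open>a\<close> works. The value
  0 must be allowed since a bound may vanish.\<close>

lemma rational_split:
  fixes a b m :: real
  assumes "m \<in> \<rat>" "0 < m" "m < a + b"
  shows "\<exists>q. q \<in> \<rat> \<times> \<rat> \<and> fst q + snd q = m \<and> 0 \<le> fst q \<and> 0 \<le> snd q \<and>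
    (fst q = 0 \<or> fst q < a) \<and> (snd q = 0 \<or> snd q < b)"
proof -
  consider "m < a" | "m < b" | "a \<le> m" "b \<le> m" by linarith
  then show ?thesis
  proof cases
    case 1
    with assms show ?thesis by (intro exI[of _ "(m, 0)"]) auto
  next
    case 2
    with assms show ?thesis by (intro exI[of _ "(0, m)"]) auto
  next
    case 3
    obtain u where "u \<in> \<rat>" "m - b < u" "u < a"
      using Rats_dense_in_real[of "m - b" a] assms(3) by auto
    with 3 assms show ?thesis by (intro exI[of _ "(u, m - u)"]) auto
  qed
qed

text \<open>Player I keeps each current mass strictly below the measure of \<open>K\<close> in the
  current cylinder. Player II must avoid mass 0, so every cylinder along the run meets
  \<open>K\<close>, and closedness puts the outcome into \<open>K\<close>.\<close>

lemma play_on_closed_set: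
  fixes \<mu> :: "(nat \<Rightarrow> bool) measure"
  assumes "prob_space \<mu>" "sets \<mu> = sets borel" "0 \<le> s"
    and win: "winning_strategy_II \<mu> s A \<tau>"
    and K: "closed K" "s < measure \<mu> K"
  shows "reachable \<mu> s \<tau> [] \<inter> K \<noteq> {}"
proof -
  interpret prob_space \<mu> by fact
  have sets [measurable_cong]: "sets \<mu> = sets borel" by fact
  have Kb [measurable]: "K \<in> sets borel" using K(1) by (rule borel_closed)
  define k where "k t = measure \<mu> (K \<inter> cyl t)" for t
  have k_split: "k t = k (t @ [False]) + k (t @ [True])" for t
    unfolding k_def by (rule measure_cyl_split[OF assms(1,2) Kb])
  have k_le: "k t \<le> measure \<mu> (cyl t)" for t
    unfolding k_def using sets by (intro finite_measure_mono) auto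
  obtain m0 where m0: "m0 \<in> \<rat>" "s < m0" "m0 < measure \<mu> K"
    using Rats_dense_in_real[OF K(2)] by blast
  have "\<forall>t m. \<exists>q. m \<in> \<rat> \<and> 0 < m \<and> m < k t \<longrightarrow> q \<in> \<rat> \<times> \<rat> \<and> fst q + snd q = m \<and>
      0 \<le> fst q \<and> 0 \<le> snd q \<and> (fst q = 0 \<or> fst q < k (t @ [False])) \<and>
      (snd q = 0 \<or> snd q < k (t @ [True]))"
    using rational_split k_split by metis
  then obtain split where split: "\<And>t m. m \<in> \<rat> \<Longrightarrow> 0 < m \<Longrightarrow> m < k t \<Longrightarrow>
      split t m \<in> \<rat> \<times> \<rat> \<and> fst (split t m) + snd (split t m) = m \<and>
      0 \<le> fst (split t m) \<and> 0 \<le> snd (split t m) \<and>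
      (fst (split t m) = 0 \<or> fst (split t m) < k (t @ [False])) \<and>
      (snd (split t m) = 0 \<or> snd (split t m) < k (t @ [True]))"
    by metis
  \<comment> \<open>The current mass is recovered from the history: \<open>m0\<close> at the start,
    afterwards the entry of the last pair selected by the last digit.\<close>
  define \<sigma> where "\<sigma> ps xs =
    split xs (if ps = [] then m0 else choose_mass (last ps) (last xs))" for ps xs
  obtain p x where run: "follows_II \<tau> p x" and p: "\<And>n. p n = \<sigma> (restr p n) (restr x n)"
    using ex_run_against[of \<tau> \<sigma>] by blast
  have p0: "p 0 = split [] m0" using p[of 0] by (simp add: \<sigma>_def)
  have "k [] = measure \<mu> K" by (simp add: k_def)
  then have *: "m0 \<in> \<rat>" "0 < m0" "m0 < k []" using m0 assms(3) by auto
  have mass0: "run_mass p x 0 = m0" using split[OF *] by (simp add: p0)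
  have p_eq: "p n = split (restr x n) (run_mass p x n)" for n
    using p[of n] mass0 by (cases n) (auto simp: \<sigma>_def restr_Suc)
  have move: "legal_I \<mu> s p x n \<and> run_mass p x (Suc n) \<in> \<rat> \<and> 0 \<le> run_mass p x (Suc n) \<and>
      (run_mass p x (Suc n) = 0 \<or> run_mass p x (Suc n) < k (restr x (Suc n)))"
    if inv: "run_mass p x n \<in> \<rat>" "0 < run_mass p x n" "run_mass p x n < k (restr x n)" for n
  proof -
    have sp: "choose_mass (p n) i \<in> \<rat> \<and> 0 \<le> choose_mass (p n) i \<and>
        (choose_mass (p n) i = 0 \<or> choose_mass (p n) i < k (restr x n @ [i]))" for i
      using split[OF inv] unfolding p_eq[of n, symmetric]
      by (cases i) (auto simp: choose_mass_def mem_Times_iff)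
    have "legal_mass \<mu> (restr x n @ [i]) (choose_mass (p n) i)" for i
      using sp[of i] k_le[of "restr x n @ [i]"] unfolding legal_mass_def by auto
    moreover have "fst (p n) + snd (p n) = run_mass p x n"
      using split[OF inv] unfolding p_eq[of n, symmetric] by auto
    moreover have "legal_mass \<mu> [] (run_mass p x 0) \<and> fst (p 0) + snd (p 0) > s"
      using mass0 m0 * k_le[of "[]"] unfolding legal_mass_def by auto
    ultimately show ?thesis
      using sp[of "x n"] by (auto simp: legal_I_def restr_Suc)
  qed
  have inv: "run_mass p x n \<in> \<rat> \<and> 0 < run_mass p x n \<and> run_mass p x n < k (restr x n)"
    if "\<forall>j<n. legal_II p x j" for n
    using that
  proof (induction n)
    case 0
    show ?case using mass0 * by simp
  next
    case (Suc n)
    then have "legal_II p x n" by simp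
    moreover note move[of n]
    ultimately show ?case using Suc by (auto simp: legal_II_def simp del: run_mass.simps)
  qed
  have "II_wins_run \<mu> s A p x"
    using win run by (simp add: winning_strategy_II_def)
  \<comment> \<open>While II obeys the rules, \<open>inv\<close> and \<open>move\<close> make the
    next move of player I legal. So player I never offends first, and II can only win by obeying the
    rules forever.\<close>
  then have legal: "\<forall>n. legal_I \<mu> s p x n \<and> legal_II p x n"
    unfolding II_wins_run_def using inv move by blast
  then have "x \<in> reachable \<mu> s \<tau> []"
    using run by (auto simp: reachable_def)
  moreover have "x \<in> K"
  proof (rule closed_mem_if_meets_cyls[OF K(1)])
    fix n
    have "0 < k (restr x n)" using inv[of n] legal by auto
    then show "K \<inter> cyl (restr x n) \<noteq> {}" unfolding k_def by force
  qed
  ultimately show ?thesis by blast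
qed

theorem II_wins_imp_large_borel_subset:
  fixes \<mu> :: "(nat \<Rightarrow> bool) measure"
  assumes "prob_space \<mu>" "sets \<mu> = sets borel" "0 \<le> s" "II_has_winning_strategy \<mu> s A"
  shows "\<exists>E\<in>sets borel. E \<subseteq> A \<and> 1 - s \<le> measure \<mu> E"
proof -
  interpret prob_space \<mu> by fact
  obtain \<tau> where \<tau>: "winning_strategy_II \<mu> s A \<tau>"
    using assms(4) by (auto simp: II_has_winning_strategy_def)
  obtain E H where EH: "E \<in> sets borel" "H \<in> sets borel" "E \<subseteq> reachable \<mu> s \<tau> []"
      "reachable \<mu> s \<tau> [] \<subseteq> H" "measure \<mu> E = measure \<mu> H"
    using reachable_inner_approx[OF assms(1,2)] by metis
  have "1 - s \<le> measure \<mu> H"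
  proof (rule ccontr)
    assume "\<not> ?thesis"
    \<comment> \<open>The closed set is sought outside \<open>H\<close> because inner regularity
      applies to Borel sets, which the reachable set need not be.\<close>
    then have "s < measure \<mu> (- H)"
      using prob_compl[of H] EH(2) assms(2) sets_eq_imp_space_eq[OF assms(2)]
      by (simp add: Compl_eq_Diff_UNIV)
    then obtain K where "closed K" "K \<subseteq> - H" "s < measure \<mu> K"
      using closed_inner_regular[OF assms(1,2), of "- H" s] EH(2) by auto
    with play_on_closed_set[OF assms(1-3) \<tau>, of K] EH(4) show False by blast
  qed
  with EH reachable_subset[OF \<tau>] show ?thesis by (metis subset_trans)
qed

section \<open>Player II playing for a set of full measure\<close>

theorem full_measure_imp_II_wins:
  fixes \<mu> :: "(nat \<Rightarrow> bool) measure"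
  assumes "prob_space \<mu>" "sets \<mu> = sets borel" "E \<in> sets borel" "measure \<mu> E = 1" "E \<subseteq> A"
  shows "II_has_winning_strategy \<mu> 0 A"
proof -
  interpret prob_space \<mu> by fact
  have space: "space \<mu> = UNIV" using sets_eq_imp_space_eq[OF assms(2)] by simp
  have "\<forall>m. \<exists>F. 0 < m \<longrightarrow> closed F \<and> F \<subseteq> E \<and> 1 - m < measure \<mu> F"
    using closed_inner_regular[OF assms(1-3)] assms(4) by (metis diff_less_eq less_add_same_cancel1)
  then obtain F :: "real \<Rightarrow> (nat \<Rightarrow> bool) set" where
    F: "\<And>m. 0 < m \<Longrightarrow> closed (F m) \<and> F m \<subseteq> E \<and> 1 - m < measure \<mu> (F m)"
    by metis
  \<comment> \<open>The first pair reveals the initial mass and thereby fixes the closed set; the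
    last pair is the current offer. Digit 0 is played iff the mass offered there exceeds the measure
    outside the closed set.\<close>
  define \<tau> :: strategy_II where "\<tau> ps xs \<longleftrightarrow>
    \<not> measure \<mu> (- F (fst (hd ps) + snd (hd ps)) \<inter> cyl (xs @ [False])) < fst (last ps)" for ps xs
  have "II_wins_run \<mu> 0 A p x" if run: "follows_II \<tau> p x" for p x
  proof -
    define C where "C = F (run_mass p x 0)"
    define v where "v t = measure \<mu> (- C \<inter> cyl t)" for t
    have "hd (restr p (Suc n)) = p 0" for n
      by (simp add: restr_def upt_conv_Cons del: upt_Suc)
    then have x: "x n \<longleftrightarrow> \<not> v (restr x n @ [False]) < fst (p n)" for n
      using run unfolding follows_II_def \<tau>_def v_def C_def by (simp add: restr_Suc)
    have start: "closed C \<and> C \<subseteq> E \<and> v [] < run_mass p x 0" if "legal_I \<mu> 0 p x 0"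
    proof -
      have m: "0 < run_mass p x 0" using that by (simp add: legal_I_def)
      have C: "closed C" "C \<subseteq> E" "1 - run_mass p x 0 < measure \<mu> C" using F[OF m] by (auto simp: C_def)
      then have "C \<in> sets \<mu>" using assms(2) by (simp add: borel_closed)
      then have "v [] = 1 - measure \<mu> C"
        using prob_compl[of C] by (simp add: v_def space Compl_eq_Diff_UNIV)
      with C show ?thesis by simp
    qed
    \<comment> \<open>Both sides add up over the two extensions, so the strict inequality survives
      on at least one of them, and \<open>x\<close> picks such a one. The second premise serves
      \<open>n = 0\<close>, where the first is vacuous.\<close>
    have inv: "v (restr x n) < run_mass p x n" if "\<forall>k<n. legal_I \<mu> 0 p x k" "legal_I \<mu> 0 p x 0" for n
      using that
    proof (induction n)
      case 0
      then show ?case using start by simp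
    next
      case (Suc n)
      have "- C \<in> sets borel" using start Suc.prems(2) by (auto intro: borel_closed)
      then have "v (restr x n) = v (restr x n @ [False]) + v (restr x n @ [True])"
        unfolding v_def by (rule measure_cyl_split[OF assms(1,2)])
      moreover have "fst (p n) + snd (p n) = run_mass p x n"
        using Suc.prems(1) by (auto simp: legal_I_def simp del: run_mass.simps)
      ultimately show ?case
        using Suc x[of n] by (cases "x n") (auto simp: choose_mass_def restr_Suc)
    qed
    have v_ge: "0 \<le> v t" for t by (simp add: v_def)
    show ?thesis
    proof (cases "\<forall>n. legal_I \<mu> 0 p x n")
      case False
      define n where "n = (LEAST n. \<not> legal_I \<mu> 0 p x n)"
      have n: "\<not> legal_I \<mu> 0 p x n" using False unfolding n_def by (metis LeastI)
      have lt: "legal_I \<mu> 0 p x k" if "k < n" for k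
        using not_less_Least that unfolding n_def by blast
      \<comment> \<open>Masses above \<open>v\<close> are positive, so II obeys the rules until
        player I errs.\<close>
      have "legal_II p x k" if "k < n" for k
      proof -
        have "v (restr x (Suc k)) < run_mass p x (Suc k)"
          using lt that by (intro inv) auto
        with v_ge[of "restr x (Suc k)"] show ?thesis unfolding legal_II_def by linarith
      qed
      with n lt show ?thesis unfolding II_wins_run_def by blast
    next
      case True
      have pos: "v (restr x n) < run_mass p x n" for n using True inv by blast
      have "legal_II p x n" for n
        using pos[of "Suc n"] v_ge[of "restr x (Suc n)"] unfolding legal_II_def by linarith
      moreover have "x \<in> C"
      proof (rule closed_mem_if_meets_cyls)
        show "closed C" using start True by blast
        fix n
        show "C \<inter> cyl (restr x n) \<noteq> {}"
        proof
          \<comment> \<open>If the cylinder missed \<open>C\<close>, the mass would exceed the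
            measure of the whole cylinder, against the rules for player I.\<close>
          assume "C \<inter> cyl (restr x n) = {}"
          then have "v (restr x n) = measure \<mu> (cyl (restr x n))"
            unfolding v_def by (intro arg_cong[where f = "measure \<mu>"]) blast
          moreover have "run_mass p x n \<le> measure \<mu> (cyl (restr x n))"
          proof (cases n)
            case 0
            have "legal_mass \<mu> [] (run_mass p x 0)" using True unfolding legal_I_def by blast
            then show ?thesis by (simp add: 0 legal_mass_def)
          next
            case (Suc k)
            have "legal_mass \<mu> (restr x k @ [x k]) (choose_mass (p k) (x k))"
              using True unfolding legal_I_def by blast
            then show ?thesis by (simp add: Suc restr_Suc legal_mass_def)
          qed
          ultimately show False using pos[of n] by simp
        qed
      qed
      ultimately show ?thesis
        using True start assms(5) unfolding II_wins_run_def by blast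
    qed
  qed
  then show ?thesis
    unfolding II_has_winning_strategy_def winning_strategy_II_def by blast
qed

section \<open>Combining the games by the Borel-Cantelli lemma\<close>

theorem theorem3p1:
  fixes \<mu> :: "(nat \<Rightarrow> bool) measure"
    and s :: "nat \<Rightarrow> real"
    and A :: "nat \<Rightarrow> (nat \<Rightarrow> bool) set"
  assumes "prob_space \<mu>"
    and "sets \<mu> = sets borel"
    and "\<And>i. 0 \<le> s i \<and> s i < 1"
    and "summable s"
    and "\<And>i. II_has_winning_strategy \<mu> (s i) (A i)"
  shows "II_has_winning_strategy \<mu> 0 (\<Union>m\<in>{1..}. \<Inter>i\<in>{m..}. A i)"
proof -
  interpret prob_space \<mu> by fact
  have space: "space \<mu> = UNIV" using sets_eq_imp_space_eq[OF assms(2)] by simp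
  have "\<forall>i. \<exists>E\<in>sets borel. E \<subseteq> A i \<and> 1 - s i \<le> measure \<mu> E"
    using II_wins_imp_large_borel_subset[OF assms(1,2)] assms(3,5) by blast
  then obtain E where E: "\<And>i. E i \<in> sets borel" "\<And>i. E i \<subseteq> A i" "\<And>i. 1 - s i \<le> measure \<mu> (E i)"
    by metis
  have Ec: "measure \<mu> (space \<mu> - E i) \<le> s i" for i
    using prob_compl[of "E i"] E(1,3)[of i] assms(2) by simp
  \<comment> \<open>\<open>Z\<close> collects the points outside infinitely many \<open>E i\<close>;
    it is null since the complements have measures bounded by the summable \<open>s\<close>.\<close>
  define Z where "Z = limsup (\<lambda>i. space \<mu> - E i)"
  have "Z \<in> null_sets \<mu>"
    unfolding Z_def
  proof (rule borel_cantelli_limsup1)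
    show "summable (\<lambda>i. measure \<mu> (space \<mu> - E i))"
      by (rule summable_comparison_test'[OF assms(4), of 0]) (use Ec in auto)
  qed (use E(1) assms(2) in \<open>auto simp: less_top[symmetric]\<close>)
  then have Z: "Z \<in> sets \<mu>" "measure \<mu> Z = 0"
    by (auto simp: null_sets_def measure_def)
  show ?thesis
  proof (rule full_measure_imp_II_wins[OF assms(1,2)])
    show "- Z \<in> sets borel" using Z assms(2) by auto
    show "measure \<mu> (- Z) = 1"
      using prob_compl[OF Z(1)] Z(2) by (simp add: space Compl_eq_Diff_UNIV)
    show "- Z \<subseteq> (\<Union>m\<in>{1..}. \<Inter>i\<in>{m..}. A i)"
    proof
      fix x assume "x \<in> - Z"
      then obtain n where "\<forall>i\<ge>n. x \<in> E i"
        by (auto simp: Z_def limsup_INF_SUP space)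
      \<comment> \<open>\<open>Suc n\<close> replaces \<open>n\<close> because the union ranges over
        indices from 1 on.\<close>
      then have "x \<in> (\<Inter>i\<in>{Suc n..}. A i)" using E(2) by fastforce
      then show "x \<in> (\<Union>m\<in>{1..}. \<Inter>i\<in>{m..}. A i)" by fastforce
    qed
  qed
qed

end
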